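(* Let $\kappa$ be an infinite cardinal. If a space $X$ belongs to the class $\mathcal C_\kappa$, then $\operatorname{c}(X)\le\kappa$.
   Context: $\operatorname{c}(X)$ is the cellularity of $X$, i.e. the least infinite cardinal $\lambda$ such that every family of pairwise disjoint non-empty open subsets of $X$ has cardinality $\le\lambda$. A continuous surjection $f:X\to Y$ is skeletal if for every non-empty open $U\subseteq X$ the closure of $f[U]$ has non-empty interior. A directed set $\Sigma$ is $\kappa$-complete if every chain of length $\le\kappa$ consisting of elements of $\Sigma$ has a least upper bound in $\Sigma$. An inverse system $\{X_\sigma,\pi^\sigma_\varrho,\Sigma\}$ is $\kappa$-complete if $\Sigma$ is $\kappa$-complete and for every chain $A\subseteq\Sigma$ with $|A|\le\kappa$ and $\sigma=\sup A\in\Sigma$ we have $X_\sigma=\varprojlim\{X_\alpha,\pi^\beta_\alpha,A\}$. All bonding maps are assumed to be (continuous) surjections. $\mathcal C_\kappa$ is the class of all spaces that are (homeomorphic to) inverse limits of $\kappa$-complete inverse systems $\{X_\sigma,\pi^\sigma_\varrho,\Sigma\}$ in which every $X_\sigma$ is a $T_0$-space of weight $\operatorname{w}(X_\sigma)\le\kappa$ and all bonding maps $\pi^\sigma_\varrho$ are skeletal.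
   Formalization: The inverse systems defining the class C_κ are additionally required to have surjective limit projections X → X_σ; with only the bonding maps surjective the claim fails already for κ = ℵ_0. *)

theory Defs
  imports "HOL-Analysis.Analysis"
begin

unbundle cardinal_syntax

definition base_of_topology :: "'x topology \<Rightarrow> 'x set set \<Rightarrow> bool" where
  "base_of_topology X \<B> \<longleftrightarrow>
     (\<forall>V\<in>\<B>. openin X V) \<and>
     (\<forall>U x. openin X U \<and> x \<in> U \<longrightarrow> (\<exists>V\<in>\<B>. x \<in> V \<and> V \<subseteq> U))"

definition weight :: "'x topology \<Rightarrow> 'x set rel" where
  "weight X = (SOME r. \<exists>\<B>. base_of_topology X \<B> \<and> r = |\<B>| \<and>
                 (\<forall>\<B>'. base_of_topology X \<B>' \<longrightarrow> |\<B>| \<le>o |\<B>'| ))"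

definition cellular_bound :: "'x topology \<Rightarrow> 'k rel \<Rightarrow> bool" where
  "cellular_bound X l \<longleftrightarrow>
     (\<forall>\<F>. (\<forall>U\<in>\<F>. openin X U \<and> U \<noteq> {}) \<and> pairwise disjnt \<F> \<longrightarrow> |\<F>| \<le>o l)"

text \<open>The summand \<^typ>\<open>nat\<close> makes room for an infinite cardinal when \<^typ>\<open>'x\<close> is finite.
  That the minimum over cardinals on this one type is a minimum over cardinals on all types
  is \<open>cellularity_least\<close> below.\<close>

definition cellularity :: "'x topology \<Rightarrow> ('x set + nat) rel" where
  "cellularity X = (SOME l. Cinfinite l \<and> cellular_bound X l \<and>
     (\<forall>l' :: ('x set + nat) rel. Cinfinite l' \<and> cellular_bound X l' \<longrightarrow> l \<le>o l'))"

definition skeletal_map :: "'x topology \<Rightarrow> 'y topology \<Rightarrow> ('x \<Rightarrow> 'y) \<Rightarrow> bool" where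
  "skeletal_map X Y f \<longleftrightarrow>
     continuous_map X Y f \<and> f ` topspace X = topspace Y \<and>
     (\<forall>U. openin X U \<and> U \<noteq> {} \<longrightarrow> Y interior_of (Y closure_of (f ` U)) \<noteq> {})"

text \<open>An index set is a set \<open>S\<close> with a preorder \<open>r\<close>; \<open>(a, b) \<in> r\<close> means that \<open>a\<close> is below \<open>b\<close>.
  Antisymmetry is not required, so every directed partial order is covered.\<close>

definition directed_set :: "'i set \<Rightarrow> 'i rel \<Rightarrow> bool" where
  "directed_set S r \<longleftrightarrow>
     S \<noteq> {} \<and> preorder_on S r \<and> (\<forall>a\<in>S. \<forall>b\<in>S. \<exists>c\<in>S. (a, c) \<in> r \<and> (b, c) \<in> r)"

definition is_supremum :: "'i set \<Rightarrow> 'i rel \<Rightarrow> 'i set \<Rightarrow> 'i \<Rightarrow> bool" where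
  "is_supremum S r A s \<longleftrightarrow>
     s \<in> S \<and> (\<forall>a\<in>A. (a, s) \<in> r) \<and> (\<forall>u\<in>S. (\<forall>a\<in>A. (a, u) \<in> r) \<longrightarrow> (s, u) \<in> r)"

definition small_chain :: "'k rel \<Rightarrow> 'i set \<Rightarrow> 'i rel \<Rightarrow> 'i set \<Rightarrow> bool" where
  "small_chain \<kappa> S r A \<longleftrightarrow> A \<subseteq> S \<and> A \<in> Chains r \<and> A \<noteq> {} \<and> |A| \<le>o \<kappa>"

definition complete_directed_set :: "'k rel \<Rightarrow> 'i set \<Rightarrow> 'i rel \<Rightarrow> bool" where
  "complete_directed_set \<kappa> S r \<longleftrightarrow>
     directed_set S r \<and> (\<forall>A. small_chain \<kappa> S r A \<longrightarrow> (\<exists>s. is_supremum S r A s))"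

text \<open>\<open>p b a\<close> is the bonding map from \<open>Xs b\<close> to \<open>Xs a\<close>, for \<open>a\<close> below \<open>b\<close>. The spaces of a
  system have one common point type \<^typ>\<open>'x\<close>; as it is arbitrary, this is no restriction.\<close>

definition inverse_system ::
  "'i set \<Rightarrow> 'i rel \<Rightarrow> ('i \<Rightarrow> 'x topology) \<Rightarrow> ('i \<Rightarrow> 'i \<Rightarrow> 'x \<Rightarrow> 'x) \<Rightarrow> bool" where
  "inverse_system S r Xs p \<longleftrightarrow>
     directed_set S r \<and>
     (\<forall>a\<in>S. \<forall>b\<in>S. (a, b) \<in> r \<longrightarrow>
        continuous_map (Xs b) (Xs a) (p b a) \<and> p b a ` topspace (Xs b) = topspace (Xs a)) \<and>
     (\<forall>a\<in>S. \<forall>x\<in>topspace (Xs a). p a a x = x) \<and>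
     (\<forall>a\<in>S. \<forall>b\<in>S. \<forall>c\<in>S. (a, b) \<in> r \<and> (b, c) \<in> r \<longrightarrow>
        (\<forall>x\<in>topspace (Xs c). p b a (p c b x) = p c a x))"

definition inverse_limit ::
  "'i set \<Rightarrow> 'i rel \<Rightarrow> ('i \<Rightarrow> 'x topology) \<Rightarrow> ('i \<Rightarrow> 'i \<Rightarrow> 'x \<Rightarrow> 'x) \<Rightarrow> ('i \<Rightarrow> 'x) topology" where
  "inverse_limit A r Xs p =
     subtopology (product_topology Xs A) {x. \<forall>a\<in>A. \<forall>b\<in>A. (a, b) \<in> r \<longrightarrow> p b a (x b) = x a}"

text \<open>For \<open>s = sup A\<close>, the identification of \<open>Xs s\<close> with the limit over \<open>A\<close> is the canonical one,
  given by the bonding maps.\<close>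

definition complete_inverse_system ::
  "'k rel \<Rightarrow> 'i set \<Rightarrow> 'i rel \<Rightarrow> ('i \<Rightarrow> 'x topology) \<Rightarrow> ('i \<Rightarrow> 'i \<Rightarrow> 'x \<Rightarrow> 'x) \<Rightarrow> bool" where
  "complete_inverse_system \<kappa> S r Xs p \<longleftrightarrow>
     inverse_system S r Xs p \<and> complete_directed_set \<kappa> S r \<and>
     (\<forall>A s. small_chain \<kappa> S r A \<and> is_supremum S r A s \<longrightarrow>
        homeomorphic_map (Xs s) (inverse_limit A r Xs p) (\<lambda>x. \<lambda>a\<in>A. p s a x))"

text \<open>The convention that the maps of a system are onto is applied to the limit projections as
  well. This does not follow from surjectivity of the bonding maps. Let \<open>D\<close> be a set of
  \<open>\<aleph>\<^sub>1\<close> reals that contains 0 and 1 and meets every interval in \<open>\<aleph>\<^sub>1\<close> points, and let \<open>Z\<close> consist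
  of 0 and the indicators of the singletons of \<open>\<omega>\<^sub>2\<close>. For countable \<open>A \<subseteq> \<omega>\<^sub>2\<close> let \<open>X\<^sub>A \<subseteq> D\<^sup>A\<close>
  consist of all injections and all restrictions of members of \<open>Z\<close>. With restrictions as bonding
  maps this is a skeletal \<open>\<aleph>\<^sub>0\<close>-complete system of second countable Hausdorff spaces, but no map
  from \<open>\<omega>\<^sub>2\<close> to \<open>D\<close> is injective, so its limit is \<open>Z\<close>, of cellularity \<open>\<aleph>\<^sub>2\<close>.\<close>

definition limit_projections_onto ::
  "'i set \<Rightarrow> 'i rel \<Rightarrow> ('i \<Rightarrow> 'x topology) \<Rightarrow> ('i \<Rightarrow> 'i \<Rightarrow> 'x \<Rightarrow> 'x) \<Rightarrow> bool" where
  "limit_projections_onto S r Xs p \<longleftrightarrow>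
     (\<forall>a\<in>S. (\<lambda>x. x a) ` topspace (inverse_limit S r Xs p) = topspace (Xs a))"

text \<open>The class cannot quantify over types, so it carries the index type and the point type of
  the system as parameters.\<close>

definition skeletal_class :: "'i itself \<Rightarrow> 'x itself \<Rightarrow> 'k rel \<Rightarrow> 'y topology \<Rightarrow> bool" where
  "skeletal_class _ _ \<kappa> X \<longleftrightarrow>
     (\<exists>(S :: 'i set) r (Xs :: 'i \<Rightarrow> 'x topology) p.
        complete_inverse_system \<kappa> S r Xs p \<and>
        limit_projections_onto S r Xs p \<and>
        (\<forall>a\<in>S. t0_space (Xs a) \<and> weight (Xs a) \<le>o \<kappa>) \<and>
        (\<forall>a\<in>S. \<forall>b\<in>S. (a, b) \<in> r \<longrightarrow> skeletal_map (Xs b) (Xs a) (p b a)) \<and>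
        X homeomorphic_space inverse_limit S r Xs p)"

lemma weight_spec:
  "\<exists>\<B>. base_of_topology X \<B> \<and> weight X = |\<B>| \<and>
      (\<forall>\<B>'. base_of_topology X \<B>' \<longrightarrow> |\<B>| \<le>o |\<B>'| )"
proof -
  let ?R = "{|\<B>| | \<B>. base_of_topology X \<B>}"
  have "base_of_topology X {U. openin X U}"
    by (auto simp: base_of_topology_def)
  then have "?R \<noteq> {}" by blast
  moreover have "\<forall>r\<in>?R. Card_order r" by (auto simp: card_of_Card_order)
  ultimately have "\<exists>r\<in>?R. \<forall>r'\<in>?R. r \<le>o r'"
    by (rule exists_minim_Card_order)
  then obtain r where "r \<in> ?R" "\<forall>r'\<in>?R. r \<le>o r'"
    by (rule bexE)
  then have "\<exists>r \<B>. base_of_topology X \<B> \<and> r = |\<B>| \<and>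
      (\<forall>\<B>'. base_of_topology X \<B>' \<longrightarrow> |\<B>| \<le>o |\<B>'| )" by blast
  then show ?thesis unfolding weight_def by (rule someI_ex)
qed

lemma cellularity_spec:
  fixes X :: "'x topology"
  shows "Cinfinite (cellularity X) \<and> cellular_bound X (cellularity X) \<and>
    (\<forall>l' :: ('x set + nat) rel. Cinfinite l' \<and> cellular_bound X l' \<longrightarrow> cellularity X \<le>o l')"
proof -
  let ?R = "{l :: ('x set + nat) rel. Cinfinite l \<and> cellular_bound X l}"
  let ?U = "UNIV :: ('x set + nat) set"
  have "cellular_bound X |?U|"
    unfolding cellular_bound_def
    by (intro allI impI card_of_ordLeqI[where f = Inl]) (auto simp: inj_on_def)
  moreover have "cinfinite |?U|"
    by (simp add: cinfinite_def Field_card_of)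
  ultimately have "|?U| \<in> ?R"
    using card_of_Card_order[of ?U] by blast
  then have "?R \<noteq> {}" by blast
  moreover have "\<forall>r\<in>?R. Card_order r" by auto
  ultimately have "\<exists>l\<in>?R. \<forall>l'\<in>?R. l \<le>o l'"
    by (rule exists_minim_Card_order)
  then obtain l where "l \<in> ?R" "\<forall>l'\<in>?R. l \<le>o l'"
    by (rule bexE)
  then have "\<exists>l :: ('x set + nat) rel. Cinfinite l \<and> cellular_bound X l \<and>
    (\<forall>l' :: ('x set + nat) rel. Cinfinite l' \<and> cellular_bound X l' \<longrightarrow> l \<le>o l')"
    unfolding mem_Collect_eq Ball_def by blast
  then show ?thesis unfolding cellularity_def by (rule someI_ex)
qed

lemma cellularity_least:
  fixes X :: "'x topology" and l :: "'k rel"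
  assumes l: "Cinfinite l" and b: "cellular_bound X l"
  shows "cellularity X \<le>o l"
proof (rule ccontr)
  let ?c = "cellularity X"
  have c: "Card_order ?c" using cellularity_spec by blast
  assume n: "\<not> ?c \<le>o l"
  have "l <o ?c"
    using n not_ordLeq_iff_ordLess[OF card_order_on_well_order_on card_order_on_well_order_on] l c
    by blast
  then have "|Field l| \<le>o |Field ?c|"
    by (intro card_of_mono2 ordLess_imp_ordLeq)
  then obtain A where A: "A \<subseteq> Field ?c" "|Field l| =o |A|"
    using internalize_card_of_ordLeq2[of "Field l" "Field ?c"] by blast
  have e: "l =o |A|"
    using ordIso_transitive[OF ordIso_symmetric[OF card_of_Field_ordIso] A(2)] l by blast
  have "Cinfinite |A|" using Cinfinite_cong[OF e l] .
  moreover have "cellular_bound X |A|"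
    using b ordLeq_ordIso_trans[OF _ e] unfolding cellular_bound_def by blast
  ultimately have "?c \<le>o |A|" using cellularity_spec by blast
  from ordLeq_ordIso_trans[OF this ordIso_symmetric[OF e]] n show False by contradiction
qed

end

(* Let F be a disjoint family of basic open sets, each the preimage of an open subset of one
   coordinate space. Build an increasing sequence of indices: at each index, choose for every set W
   of a small base there a member of F met by the preimage of W, if there is one, and climb past
   the coordinates of the chosen members. Let s be the supremum of the sequence; by completeness
   of the system the preimages of these bases form a base of X_s. For U in F, the closure of its
   image in X_s contains some such W, because the limit projections are skeletal. The member
   chosen for W depends only on coordinates below s, so it meets U and hence equals U. Thus every
   member of F was chosen, and there were at most \<kappa> choices. *)

theory Submission
  imports Defs
begin

section \<open>Upper bounds in a \<kappa>-complete directed set\<close>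

text \<open>Completeness bounds only chains, so \<open>A\<close> is replaced by a chain: along a
  well-order of \<open>A\<close>, transfinite recursion assigns to each element a value above it and
  above all earlier values. Such values form a chain of at most \<kappa> elements.\<close>

lemma small_subset_upper_bound:
  assumes S: "complete_directed_set \<kappa> S r" and A: "A \<subseteq> S" "|A| \<le>o \<kappa>"
  shows "\<exists>s\<in>S. \<forall>a\<in>A. (a, s) \<in> r"
proof -
  have dir: "S \<noteq> {}" "\<And>a b. a \<in> S \<Longrightarrow> b \<in> S \<Longrightarrow> \<exists>c\<in>S. (a, c) \<in> r \<and> (b, c) \<in> r"
    and r: "refl_on S r" "trans r"
    and sup: "\<And>C. small_chain \<kappa> S r C \<Longrightarrow> \<exists>s. is_supremum S r C s"
    using S unfolding complete_directed_set_def directed_set_def preorder_on_def by blast+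
  define R where "R = |A| - Id"
  have wo: "well_order_on A |A|"
    by (rule card_of_well_order_on)
  have wfR: "wf R"
    using wo unfolding R_def well_order_on_def by blast
  have lin: "b = c \<or> (b, c) \<in> R \<or> (c, b) \<in> R" if "b \<in> A" "c \<in> A" for b c
    using wo that unfolding R_def well_order_on_def linear_order_on_def total_on_def by blast
  \<comment> \<open>The value at \<open>a\<close> is an upper bound of \<open>a\<close> and of the
    values at its predecessors. \<open>SOME\<close> presupposes that one exists, which is shown only
    in \<open>good\<close>, by induction.\<close>
  define t where "t = wfrec R (\<lambda>t a. SOME u. u \<in> S \<and> (a, u) \<in> r \<and>
      (\<forall>b\<in>A. (b, a) \<in> R \<longrightarrow> (t b, u) \<in> r))"
  have t: "t a = (SOME u. u \<in> S \<and> (a, u) \<in> r \<and> (\<forall>b\<in>A. (b, a) \<in> R \<longrightarrow> (t b, u) \<in> r))" for a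
    unfolding t_def by (subst wfrec[OF wfR]) (simp add: cut_apply cong: conj_cong)
  \<comment> \<open>Stated for a subset \<open>B\<close> because it serves twice: for the
    predecessors of an element in the induction, and for all of \<open>A\<close> at the end. The
    empty \<open>B\<close> is separate since a small chain is non-empty.\<close>
  have chain: "\<exists>s\<in>S. \<forall>b\<in>B. (t b, s) \<in> r"
    if B: "B \<subseteq> A"
      and good: "\<And>a. a \<in> B \<Longrightarrow> t a \<in> S \<and> (\<forall>b\<in>A. (b, a) \<in> R \<longrightarrow> (t b, t a) \<in> r)" for B
  proof (cases "B = {}")
    case True
    then show ?thesis using dir(1) by blast
  next
    case False
    have "t ` B \<in> Chains r"
      unfolding Chains_def
    proof (clarify)
      fix b c assume "b \<in> B" "c \<in> B" "(t c, t b) \<notin> r"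
      moreover have "(t b, t b) \<in> r"
        using r(1) good \<open>b \<in> B\<close> by (auto simp: refl_on_def)
      ultimately show "(t b, t c) \<in> r"
        using lin[of b c] good B by auto
    qed
    moreover have "|t ` B| \<le>o \<kappa>"
      using card_of_image card_of_mono1[OF B] A(2) ordLeq_transitive by blast
    ultimately have "small_chain \<kappa> S r (t ` B)"
      using False good unfolding small_chain_def by auto
    then show ?thesis
      using sup unfolding is_supremum_def by blast
  qed
  have good: "a \<in> A \<Longrightarrow> t a \<in> S \<and> (a, t a) \<in> r \<and> (\<forall>b\<in>A. (b, a) \<in> R \<longrightarrow> (t b, t a) \<in> r)" for a
  proof (induction a rule: wf_induct_rule[OF wfR])
    case (1 a)
    obtain s where s: "s \<in> S" "\<forall>b\<in>{b\<in>A. (b, a) \<in> R}. (t b, s) \<in> r"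
      using chain[of "{b\<in>A. (b, a) \<in> R}"] 1 by blast
    \<comment> \<open>The bound \<open>s\<close> of the earlier values need not lie above
      \<open>a\<close>; directedness supplies a bound of both.\<close>
    obtain u where u: "u \<in> S" "(a, u) \<in> r" "(s, u) \<in> r"
      using dir(2)[of a s] A(1) 1(2) s(1) by blast
    have "u \<in> S \<and> (a, u) \<in> r \<and> (\<forall>b\<in>A. (b, a) \<in> R \<longrightarrow> (t b, u) \<in> r)"
      using s u r(2) by (auto dest: transD)
    then show ?case
      unfolding t[of a] by (rule someI)
  qed
  obtain s where "s \<in> S" "\<forall>b\<in>A. (t b, s) \<in> r"
    using chain[of A] good by blast
  moreover have "(a, s) \<in> r" if "a \<in> A" for a
    using good[OF that] \<open>\<forall>b\<in>A. (t b, s) \<in> r\<close> that r(2) by (blast dest: transD)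
  ultimately show ?thesis by blast
qed

section \<open>Topology of inverse limits and their projections\<close>

lemma topspace_inverse_limit:
  "topspace (inverse_limit A r Xs p) =
     {x \<in> (\<Pi>\<^sub>E a\<in>A. topspace (Xs a)). \<forall>a\<in>A. \<forall>b\<in>A. (a, b) \<in> r \<longrightarrow> p b a (x b) = x a}"
  unfolding inverse_limit_def by auto

lemma openin_inverse_limit_preimage:
  assumes "a \<in> A" "openin (Xs a) V"
  shows "openin (inverse_limit A r Xs p) {x \<in> topspace (inverse_limit A r Xs p). x a \<in> V}"
proof -
  have "continuous_map (inverse_limit A r Xs p) (Xs a) (\<lambda>x. x a)"
    unfolding inverse_limit_def
    using assms(1) by (intro continuous_map_from_subtopology continuous_map_product_projection)
  then show ?thesis
    using assms(2) by (rule openin_continuous_map_preimage)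
qed

text \<open>A basic box restricts finitely many coordinates; a coordinate above all of them
  determines them through the bonding maps, so one restriction there suffices. The index set is a
  directed \<open>A\<close> inside \<open>S\<close> because both the whole system and a sequence in
  it are needed later.\<close>

lemma inverse_limit_base:
  assumes sys: "inverse_system S r Xs p" and AS: "A \<subseteq> S" "A \<noteq> {}"
    and dir: "\<forall>a\<in>A. \<forall>b\<in>A. \<exists>c\<in>A. (a, c) \<in> r \<and> (b, c) \<in> r"
    and U: "openin (inverse_limit A r Xs p) U" "x \<in> U"
  shows "\<exists>a\<in>A. \<exists>V. openin (Xs a) V \<and> x a \<in> V \<and>
           {y \<in> topspace (inverse_limit A r Xs p). y a \<in> V} \<subseteq> U"
proof -
  let ?L = "inverse_limit A r Xs p"
  have tr: "trans r"
    using sys unfolding inverse_system_def directed_set_def preorder_on_def by blast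
  have ub: "\<exists>c\<in>A. \<forall>a\<in>F. (a, c) \<in> r" if "finite F" "F \<subseteq> A" for F
    using that
  proof (induction F)
    case empty
    then show ?case using AS by blast
  next
    case (insert b F)
    then obtain c where c: "c \<in> A" "\<forall>a\<in>F. (a, c) \<in> r" by blast
    obtain d where "d \<in> A" "(c, d) \<in> r" "(b, d) \<in> r"
      using dir insert.prems c(1) by blast
    then show ?case using c tr by (blast dest: transD)
  qed
  have xL: "x \<in> topspace ?L"
    using U openin_subset by blast
  obtain T where T: "openin (product_topology Xs A) T"
    "U = T \<inter> {x. \<forall>a\<in>A. \<forall>b\<in>A. (a, b) \<in> r \<longrightarrow> p b a (x b) = x a}"
    using U(1) unfolding inverse_limit_def openin_subtopology by blast
  obtain O' where O': "finite {i \<in> A. O' i \<noteq> topspace (Xs i)}"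
    "\<And>i. i \<in> A \<Longrightarrow> openin (Xs i) (O' i)" "x \<in> Pi\<^sub>E A O'" "Pi\<^sub>E A O' \<subseteq> T"
    using T U(2) by (auto simp: openin_product_topology_alt)
  define F where "F = {i \<in> A. O' i \<noteq> topspace (Xs i)}"
  have F: "finite F" "F \<subseteq> A"
    using O'(1) unfolding F_def by auto
  obtain c where c: "c \<in> A" "\<And>a. a \<in> F \<Longrightarrow> (a, c) \<in> r"
    using ub[OF F] by blast
  \<comment> \<open>All restrictions of the box are pulled back to the coordinate \<open>c\<close>.
    The factor \<open>topspace (Xs c)\<close> gives the right set when no coordinate is
    restricted.\<close>
  define V where "V = topspace (Xs c) \<inter> (\<Inter>a\<in>F. {y \<in> topspace (Xs c). p c a y \<in> O' a})"
  have "openin (Xs c) {y \<in> topspace (Xs c). p c a y \<in> O' a}" if "a \<in> F" for a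
  proof (rule openin_continuous_map_preimage)
    show "continuous_map (Xs c) (Xs a) (p c a)"
      using sys c that F AS unfolding inverse_system_def by blast
    show "openin (Xs a) (O' a)"
      using O'(2) that F by blast
  qed
  then have "openin (Xs c) V"
    unfolding V_def using F(1) by (cases "F = {}") (auto intro!: openin_Int openin_Inter)
  moreover have "x c \<in> V"
    using xL c F O'(3) unfolding V_def topspace_inverse_limit
    by (auto simp: PiE_iff subset_iff)
  moreover have "{y \<in> topspace ?L. y c \<in> V} \<subseteq> U"
  proof
    fix y assume y: "y \<in> {y \<in> topspace ?L. y c \<in> V}"
    have "y a \<in> O' a" if "a \<in> A" for a
    proof (cases "a \<in> F")
      case True
      then have "p c a (y c) \<in> O' a" "p c a (y c) = y a"
        using y c that unfolding V_def topspace_inverse_limit by auto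
      then show ?thesis by simp
    next
      case False
      then show ?thesis
        using y that unfolding F_def topspace_inverse_limit by (auto simp: PiE_iff)
    qed
    then have "y \<in> Pi\<^sub>E A O'"
      using y unfolding topspace_inverse_limit by (auto simp: PiE_iff)
    then show "y \<in> U"
      using O'(4) T(2) y unfolding topspace_inverse_limit by auto
  qed
  ultimately show ?thesis
    using c(1) by blast
qed

text \<open>An open set contains a cylinder over some \<open>b\<close>. Rewritten over a
  \<open>c\<close> above both \<open>a\<close> and \<open>b\<close>, its image in
  \<open>Xs a\<close> contains the image of a non-empty open set under the skeletal bonding map
  \<open>p c a\<close>.\<close>

lemma inverse_limit_projection_skeletal:
  assumes sys: "inverse_system S r Xs p" and onto: "limit_projections_onto S r Xs p"
    and sk: "\<forall>a\<in>S. \<forall>b\<in>S. (a, b) \<in> r \<longrightarrow> skeletal_map (Xs b) (Xs a) (p b a)"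
    and a: "a \<in> S"
  shows "skeletal_map (inverse_limit S r Xs p) (Xs a) (\<lambda>x. x a)"
  unfolding skeletal_map_def
proof (intro conjI allI impI)
  let ?L = "inverse_limit S r Xs p"
  have ne: "S \<noteq> {}" and dir: "\<forall>a\<in>S. \<forall>b\<in>S. \<exists>c\<in>S. (a, c) \<in> r \<and> (b, c) \<in> r"
    using sys unfolding inverse_system_def directed_set_def by auto
  show "continuous_map ?L (Xs a) (\<lambda>x. x a)"
    unfolding inverse_limit_def
    using a by (intro continuous_map_from_subtopology continuous_map_product_projection)
  show "(\<lambda>x. x a) ` topspace ?L = topspace (Xs a)"
    using onto a unfolding limit_projections_onto_def by blast
  fix U assume U: "openin ?L U \<and> U \<noteq> {}"
  then obtain x where x: "x \<in> U" by blast
  obtain b V where b: "b \<in> S" and V: "openin (Xs b) V" "x b \<in> V" "{y \<in> topspace ?L. y b \<in> V} \<subseteq> U"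
    using inverse_limit_base[OF sys subset_refl ne dir] U x by blast
  obtain c where c: "c \<in> S" "(a, c) \<in> r" "(b, c) \<in> r"
    using dir a b by blast
  define W where "W = {y \<in> topspace (Xs c). p c b y \<in> V}"
  have "continuous_map (Xs c) (Xs b) (p c b)"
    using sys b c unfolding inverse_system_def by blast
  then have W: "openin (Xs c) W"
    unfolding W_def using V(1) by (rule openin_continuous_map_preimage)
  have "x \<in> topspace ?L"
    using x U openin_subset by blast
  then have "x c \<in> W"
    using b c V(2) unfolding W_def topspace_inverse_limit by (auto simp: PiE_iff)
  then have "Xs a interior_of (Xs a closure_of (p c a ` W)) \<noteq> {}"
    using sk a c W unfolding skeletal_map_def by blast
  moreover have "p c a ` W \<subseteq> (\<lambda>x. x a) ` U"
  proof
    fix z assume "z \<in> p c a ` W"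
    then obtain w where w: "w \<in> W" "z = p c a w" by blast
    \<comment> \<open>Every point of \<open>W\<close> must be a coordinate of a point of the limit;
      this is what surjectivity of the limit projections provides.\<close>
    then have "w \<in> (\<lambda>x. x c) ` topspace ?L"
      using onto c(1) unfolding W_def limit_projections_onto_def by auto
    then obtain y where y: "y \<in> topspace ?L" "y c = w" by blast
    have "p c b (y c) = y b" "p c a (y c) = y a"
      using y(1) a b c unfolding topspace_inverse_limit by auto
    then have "y \<in> U" "z = y a"
      using w y V(3) unfolding W_def by auto
    then show "z \<in> (\<lambda>x. x a) ` U" by blast
  qed
  ultimately show "Xs a interior_of (Xs a closure_of ((\<lambda>x. x a) ` U)) \<noteq> {}"
    using interior_of_mono[OF closure_of_mono] by blast
qed

section \<open>Cellularity of the limit\<close>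

lemma cellular_bound_inverse_limit:
  fixes \<kappa> :: "'k rel"
  assumes \<kappa>: "Cinfinite \<kappa>"
    and csys: "complete_inverse_system \<kappa> S r Xs p" and onto: "limit_projections_onto S r Xs p"
    and w: "\<forall>a\<in>S. weight (Xs a) \<le>o \<kappa>"
    and sk: "\<forall>a\<in>S. \<forall>b\<in>S. (a, b) \<in> r \<longrightarrow> skeletal_map (Xs b) (Xs a) (p b a)"
  shows "cellular_bound (inverse_limit S r Xs p) \<kappa>"
  unfolding cellular_bound_def
proof (intro allI impI)
  let ?L = "inverse_limit S r Xs p"
  fix \<F> assume F: "(\<forall>U\<in>\<F>. openin ?L U \<and> U \<noteq> {}) \<and> pairwise disjnt \<F>"
  have F_open: "openin ?L U \<and> U \<noteq> {}" if "U \<in> \<F>" for U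
    using F that by simp
  have F_disjoint: "U = U'" if "U \<in> \<F>" "U' \<in> \<F>" "x \<in> U" "x \<in> U'" for U U' x
    using F that unfolding pairwise_def disjnt_iff by metis
  have sys: "inverse_system S r Xs p" and cds: "complete_directed_set \<kappa> S r"
    using csys unfolding complete_inverse_system_def by auto
  have r: "refl_on S r" "trans r"
    and ne: "S \<noteq> {}" and dir: "\<forall>a\<in>S. \<forall>b\<in>S. \<exists>c\<in>S. (a, c) \<in> r \<and> (b, c) \<in> r"
    using sys unfolding inverse_system_def directed_set_def preorder_on_def by auto
  have cont: "continuous_map (Xs b) (Xs a) (p b a)" if "a \<in> S" "b \<in> S" "(a, b) \<in> r" for a b
    using sys that unfolding inverse_system_def by blast
  have coord: "x a \<in> topspace (Xs a)" if "x \<in> topspace ?L" "a \<in> S" for x a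
    using that unfolding topspace_inverse_limit by auto
  have bond: "p b a (x b) = x a" if "x \<in> topspace ?L" "a \<in> S" "b \<in> S" "(a, b) \<in> r" for x a b
    using that unfolding topspace_inverse_limit by auto

  \<comment> \<open>The reduction to basic sets: each member of the family contains a non-empty
    cylinder over one coordinate, encoded as a pair of an index and an open set.\<close>
  define inside where "inside U aV \<longleftrightarrow> fst aV \<in> S \<and> openin (Xs (fst aV)) (snd aV) \<and>
      {x \<in> topspace ?L. x (fst aV) \<in> snd aV} \<noteq> {} \<and>
      {x \<in> topspace ?L. x (fst aV) \<in> snd aV} \<subseteq> U" for U aV
  have "\<exists>aV. inside U aV" if "U \<in> \<F>" for U
  proof -
    have "U \<noteq> {}" and U: "openin ?L U"
      using F_open[OF that] by simp_all
    then obtain x where x: "x \<in> U" by (meson ex_in_conv)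
    have xL: "x \<in> topspace ?L"
      using openin_subset[OF U] x by (rule subsetD)
    obtain a V where "a \<in> S" "openin (Xs a) V" "x a \<in> V" "{y \<in> topspace ?L. y a \<in> V} \<subseteq> U"
      using inverse_limit_base[OF sys subset_refl ne dir U x] by (elim bexE exE conjE)
    with xL show ?thesis
      by (intro exI[of _ "(a, V)"]) (auto simp: inside_def)
  qed
  then obtain aV where aV: "\<And>U. U \<in> \<F> \<Longrightarrow> inside U (aV U)"
    by metis
  define \<sigma> V where "\<sigma> U = fst (aV U)" and "V U = snd (aV U)" for U
  have \<sigma>: "\<sigma> U \<in> S" and V: "openin (Xs (\<sigma> U)) (V U)"
    and cyl: "{x \<in> topspace ?L. x (\<sigma> U) \<in> V U} \<noteq> {}"
      "{x \<in> topspace ?L. x (\<sigma> U) \<in> V U} \<subseteq> U" if "U \<in> \<F>" for U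
    using aV[OF that] unfolding inside_def \<sigma>_def V_def by auto
  define cylinder where "cylinder U = {x \<in> topspace ?L. x (\<sigma> U) \<in> V U}" for U
  have cylinder: "openin ?L (cylinder U)" "cylinder U \<noteq> {}" "cylinder U \<subseteq> U" if "U \<in> \<F>" for U
    using openin_inverse_limit_preimage[of "\<sigma> U" S Xs "V U" r p] \<sigma> V cyl that
    unfolding cylinder_def by auto

  have "\<exists>\<B>. base_of_topology (Xs a) \<B> \<and> |\<B>| \<le>o \<kappa>" if "a \<in> S" for a
    using weight_spec[of "Xs a"] w that by metis
  then obtain B where B: "\<And>a. a \<in> S \<Longrightarrow> base_of_topology (Xs a) (B a)"
      "\<And>a. a \<in> S \<Longrightarrow> |B a| \<le>o \<kappa>"
    by metis
  \<comment> \<open>The test uses the cylinder inside \<open>U\<close> rather than \<open>U\<close>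
    itself, since only the cylinder is determined by the single coordinate
    \<open>\<sigma> U\<close>.\<close>
  define meets where "meets a W U \<longleftrightarrow> U \<in> \<F> \<and> (\<exists>x\<in>cylinder U. x a \<in> W)" for a W U
  define pick where "pick a W = (SOME U. meets a W U)" for a W
  define picks where "picks a = pick a ` {W \<in> B a. \<exists>U. meets a W U}" for a
  have pick: "meets a W (pick a W)" if "meets a W U" for a W U
    unfolding pick_def using that by (rule someI)
  have picks_F: "picks a \<subseteq> \<F>" for a
    using pick unfolding picks_def meets_def by blast
  have picks_card: "|picks a| \<le>o \<kappa>" if "a \<in> S" for a
  proof -
    have "|picks a| \<le>o |{W \<in> B a. \<exists>U. meets a W U}|"
      unfolding picks_def by (rule card_of_image)
    also have "|{W \<in> B a. \<exists>U. meets a W U}| \<le>o |B a|"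
      by (rule card_of_mono1) auto
    finally show ?thesis
      using B(2)[OF that] by (rule ordLeq_transitive)
  qed
  \<comment> \<open>One climbing step: at most \<kappa> members are picked at \<open>a\<close>, so
    their coordinates have a common upper bound, which directedness joins with
    \<open>a\<close>.\<close>
  have "\<exists>b\<in>S. (a, b) \<in> r \<and> (\<forall>U\<in>picks a. (\<sigma> U, b) \<in> r)" if "a \<in> S" for a
  proof -
    have "\<sigma> ` picks a \<subseteq> S"
      using picks_F \<sigma> by blast
    moreover have "|\<sigma> ` picks a| \<le>o \<kappa>"
      using card_of_image picks_card[OF that] by (rule ordLeq_transitive)
    ultimately have "\<exists>s\<in>S. \<forall>b\<in>\<sigma> ` picks a. (b, s) \<in> r"
      by (rule small_subset_upper_bound[OF cds])
    then obtain s where s: "s \<in> S" "\<forall>U\<in>picks a. (\<sigma> U, s) \<in> r"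
      by auto
    obtain b where "b \<in> S" "(a, b) \<in> r" "(s, b) \<in> r"
      using dir \<open>a \<in> S\<close> s(1) by blast
    then show ?thesis using s(2) transD[OF r(2)] by blast
  qed
  then have "\<forall>a\<in>S. \<exists>b. b \<in> S \<and> (a, b) \<in> r \<and> (\<forall>U\<in>picks a. (\<sigma> U, b) \<in> r)"
    by blast
  from bchoice[OF this] obtain nxt where nxt: "\<And>a. a \<in> S \<Longrightarrow> nxt a \<in> S" "\<And>a. a \<in> S \<Longrightarrow> (a, nxt a) \<in> r"
      "\<And>a U. a \<in> S \<Longrightarrow> U \<in> picks a \<Longrightarrow> (\<sigma> U, nxt a) \<in> r"
    by blast
  obtain a0 where "a0 \<in> S" using ne by blast
  define \<tau> where "\<tau> n = (nxt ^^ n) a0" for n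
  have \<tau>: "\<tau> n \<in> S" for n
    by (induction n) (auto simp: \<tau>_def \<open>a0 \<in> S\<close> nxt)
  have \<tau>_mono: "(\<tau> m, \<tau> n) \<in> r" if "m \<le> n" for m n
    using that
  proof (induction rule: dec_induct)
    case base
    show ?case using r(1) \<tau> by (auto simp: refl_on_def)
  next
    case (step n)
    moreover have "(\<tau> n, \<tau> (Suc n)) \<in> r" using nxt(2)[OF \<tau>] by (simp add: \<tau>_def)
    ultimately show ?case using transD[OF r(2)] by blast
  qed
  let ?A = "range \<tau>"
  \<comment> \<open>As \<kappa> is infinite, the range of a sequence is small enough for
    completeness to give it a supremum.\<close>
  have nat_\<kappa>: "|UNIV :: nat set| \<le>o \<kappa>"
    using card_of_nat natLeq_ordLeq_cinfinite[OF \<kappa>] by (rule ordIso_ordLeq_trans)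
  have A_dir: "\<forall>a\<in>?A. \<forall>b\<in>?A. \<exists>c\<in>?A. (a, c) \<in> r \<and> (b, c) \<in> r"
  proof clarify
    fix m n
    show "\<exists>c\<in>?A. (\<tau> m, c) \<in> r \<and> (\<tau> n, c) \<in> r"
      using \<tau>_mono[of m "max m n"] \<tau>_mono[of n "max m n"] by auto
  qed
  have chain: "small_chain \<kappa> S r ?A"
    unfolding small_chain_def
  proof (intro conjI)
    show "?A \<in> Chains r"
      unfolding Chains_def using \<tau>_mono nat_le_linear by blast
    show "|?A| \<le>o \<kappa>"
      using card_of_image nat_\<kappa> by (rule ordLeq_transitive)
  qed (use \<tau> in auto)
  then obtain s where s: "is_supremum S r ?A s"
    using cds unfolding complete_directed_set_def by blast
  have sS: "s \<in> S" and \<tau>s: "\<And>n. (\<tau> n, s) \<in> r"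
    using s unfolding is_supremum_def by auto
  \<comment> \<open>Completeness makes \<open>?h\<close> a homeomorphism. Hence preimages of open
    sets of the spaces \<open>Xs (\<tau> n)\<close> form a base of \<open>Xs s\<close>.\<close>
  let ?M = "inverse_limit ?A r Xs p" and ?h = "\<lambda>x. \<lambda>a\<in>?A. p s a x"
  have hom: "homeomorphic_map (Xs s) ?M ?h"
    using csys chain s unfolding complete_inverse_system_def by blast

  have "\<F> \<subseteq> (\<Union>n. picks (\<tau> n))"
  proof
    fix U assume U: "U \<in> \<F>"
    define K where "K = Xs s closure_of ((\<lambda>x. x s) ` cylinder U)"
    have "Xs s interior_of K \<noteq> {}"
      using inverse_limit_projection_skeletal[OF sys onto sk sS] cylinder[OF U]
      unfolding K_def skeletal_map_def by blast
    then obtain g where g: "g \<in> Xs s interior_of K" by blast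
    have gs: "g \<in> topspace (Xs s)"
      using interior_of_subset_topspace g by (rule subsetD)
    \<comment> \<open>The interior of \<open>K\<close> is carried to the limit over the sequence,
      where a neighbourhood of \<open>?h g\<close> depends on a single stage
      \<open>a = \<tau> n\<close>; it is then shrunk to a member \<open>W\<close> of the small
      base.\<close>
    have "openin ?M (?h ` (Xs s interior_of K))"
      using hom homeomorphic_imp_open_map openin_interior_of unfolding open_map_def by blast
    then obtain a W' where a: "a \<in> ?A" and W': "openin (Xs a) W'" "?h g a \<in> W'"
        "{y \<in> topspace ?M. y a \<in> W'} \<subseteq> ?h ` (Xs s interior_of K)"
      using inverse_limit_base[OF sys _ _ A_dir, of "?h ` (Xs s interior_of K)" "?h g"] g \<tau> by blast
    obtain n where n: "a = \<tau> n" using a by blast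
    have gW': "p s a g \<in> W'" using W'(2) a by simp
    then obtain W where W: "W \<in> B a" "p s a g \<in> W" "W \<subseteq> W'"
      using B(1)[of a] \<tau> W'(1) unfolding n base_of_topology_def by meson
    have Wop: "openin (Xs a) W"
      using B(1)[of a] W(1) \<tau> unfolding n base_of_topology_def by blast
    \<comment> \<open>Injectivity of \<open>?h\<close> brings the inclusion back from
      \<open>?M\<close>: the preimage of \<open>W\<close> in \<open>Xs s\<close> lies in
      \<open>K\<close>.\<close>
    have WK: "y \<in> K" if y: "y \<in> topspace (Xs s)" "p s a y \<in> W" for y
    proof -
      have "?h y \<in> topspace ?M"
        using hom y(1) homeomorphic_imp_surjective_map by blast
      moreover have "?h y a \<in> W'"
        using subsetD[OF W(3) y(2)] a by simp
      ultimately have "?h y \<in> ?h ` (Xs s interior_of K)"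
        by (intro subsetD[OF W'(3)] CollectI conjI)
      then obtain z where z: "z \<in> Xs s interior_of K" "?h y = ?h z" by blast
      have "inj_on ?h (topspace (Xs s))"
        using hom by (rule homeomorphic_imp_injective_map)
      then have "y = z"
        using z(2) y(1) subsetD[OF interior_of_subset_topspace z(1)] by (rule inj_onD)
      then show ?thesis using subsetD[OF interior_of_subset z(1)] by simp
    qed
    have aS: "a \<in> S" "(a, s) \<in> r" using n \<tau> \<tau>s by auto
    have near: "\<exists>x\<in>cylinder U. x s \<in> G" if "openin (Xs s) G" "y \<in> G" "y \<in> K" for G y
      using that unfolding K_def in_closure_of by blast
    have "openin (Xs s) {y \<in> topspace (Xs s). p s a y \<in> W}"
      by (rule openin_continuous_map_preimage[OF cont[OF aS(1) sS aS(2)] Wop])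
    \<comment> \<open>The preimage of \<open>W\<close> is a neighbourhood of \<open>g\<close> in
      \<open>K\<close>, so it meets the projection of \<open>cylinder U\<close>. Thus
      \<open>U\<close> is a candidate for \<open>W\<close>, and the choice at stage \<open>n\<close>
      is a genuine one.\<close>
    from near[OF this, of g] obtain x where x: "x \<in> cylinder U" "p s a (x s) \<in> W"
      using gs W(2) WK by blast
    have "x a \<in> W"
      using x bond[OF _ aS(1) sS aS(2)] unfolding cylinder_def by auto
    then have "meets a W U"
      using U x(1) unfolding meets_def by blast
    define U' where "U' = pick a W"
    have "meets a W U'"
      unfolding U'_def using \<open>meets a W U\<close> by (rule pick)
    then obtain z where U': "U' \<in> \<F>" and z: "z \<in> cylinder U'" "z a \<in> W"
      unfolding meets_def by blast
    have "U' \<in> picks a"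
      unfolding U'_def picks_def using W(1) \<open>meets a W U\<close> by blast
    \<comment> \<open>A member picked at stage \<open>n\<close> has its coordinate below stage
      \<open>n + 1\<close>, hence below \<open>s\<close>.\<close>
    then have "(\<sigma> U', \<tau> (Suc n)) \<in> r"
      using nxt(3) aS(1) n by (simp add: \<tau>_def)
    then have \<sigma>s: "(\<sigma> U', s) \<in> r"
      using \<tau>s by (rule transD[OF r(2)])
    have zL: "z \<in> topspace ?L" "z (\<sigma> U') \<in> V U'"
      using z(1) unfolding cylinder_def by auto
    \<comment> \<open>Both conditions on \<open>z\<close>, at \<open>a\<close> and at
      \<open>\<sigma> U'\<close>, become one open condition at \<open>s\<close>. Since
      \<open>G\<close> lies in \<open>K\<close> and contains \<open>z s\<close>, it meets the
      projection of \<open>cylinder U\<close>; a point of \<open>cylinder U\<close> over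
      \<open>G\<close> also lies in \<open>cylinder U'\<close>.\<close>
    define G where "G = {y \<in> topspace (Xs s). p s a y \<in> W} \<inter>
      {y \<in> topspace (Xs s). p s (\<sigma> U') y \<in> V U'}"
    have "openin (Xs s) G"
      unfolding G_def
      using openin_continuous_map_preimage[OF cont[OF aS(1) sS aS(2)] Wop]
        openin_continuous_map_preimage[OF cont[OF \<sigma>[OF U'] sS \<sigma>s] V[OF U']]
      by (rule openin_Int)
    moreover have "z s \<in> G"
      unfolding G_def using zL z(2) bond[OF zL(1) aS(1) sS aS(2)] bond[OF zL(1) \<sigma>[OF U'] sS \<sigma>s]
        coord[OF zL(1) sS] by simp
    moreover have "z s \<in> K"
      using \<open>z s \<in> G\<close> WK unfolding G_def by blast
    ultimately obtain y where y: "y \<in> cylinder U" "y s \<in> G"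
      using near by blast
    have yL: "y \<in> topspace ?L" using y(1) unfolding cylinder_def by blast
    have "y \<in> cylinder U'"
      using y(2) yL bond[OF yL \<sigma>[OF U'] sS \<sigma>s] unfolding G_def cylinder_def by auto
    then have "y \<in> U" "y \<in> U'"
      using y(1) cylinder(3) U U' by blast+
    then have "U = U'"
      by (rule F_disjoint[OF U U'])
    then show "U \<in> (\<Union>n. picks (\<tau> n))"
      using \<open>U' \<in> picks a\<close> n by blast
  qed
  then have "|\<F>| \<le>o |\<Union>n. picks (\<tau> n)|"
    by (rule card_of_mono1)
  \<comment> \<open>A countable union of sets of size at most \<kappa>, with \<kappa>
    infinite.\<close>
  also have "|\<Union>n. picks (\<tau> n)| \<le>o \<kappa>"
    using \<kappa> nat_\<kappa> picks_card[OF \<tau>]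
    by (intro card_of_UNION_ordLeq_infinite_Field) (auto simp: cinfinite_def)
  finally show "|\<F>| \<le>o \<kappa>" .
qed

section \<open>Transfer to homeomorphic spaces and conclusion\<close>

lemma cellular_bound_homeomorphic:
  assumes "X homeomorphic_space Y" "cellular_bound Y \<kappa>"
  shows "cellular_bound X \<kappa>"
  unfolding cellular_bound_def
proof (intro allI impI)
  fix \<F> assume F: "(\<forall>U\<in>\<F>. openin X U \<and> U \<noteq> {}) \<and> pairwise disjnt \<F>"
  obtain f where f: "homeomorphic_map X Y f"
    using assms(1) homeomorphic_space by blast
  have inj: "inj_on f (topspace X)" and op: "open_map X Y f"
    using f homeomorphic_imp_injective_map homeomorphic_imp_open_map by blast+
  have sub: "U \<subseteq> topspace X" if "U \<in> \<F>" for U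
    using F that openin_subset by blast
  \<comment> \<open>Distinct members have distinct images, so the image family has the size of the
    original.\<close>
  have "inj_on ((`) f) \<F>"
    using inj sub by (auto simp: inj_on_def inj_on_image_eq_iff[OF inj])
  then have "|\<F>| \<le>o |(`) f ` \<F>|"
    by (intro card_of_ordLeqI[where f = "(`) f"]) auto
  also have "|(`) f ` \<F>| \<le>o \<kappa>"
  proof -
    have "pairwise disjnt ((`) f ` \<F>)"
      unfolding pairwise_def
    proof clarify
      fix U U' assume U: "U \<in> \<F>" "U' \<in> \<F>" "f ` U \<noteq> f ` U'"
      then have "U \<inter> U' = {}"
        using F unfolding pairwise_def disjnt_def by blast
      then show "disjnt (f ` U) (f ` U')"
        using inj_on_image_Int[OF inj sub sub, of U U'] U unfolding disjnt_def by simp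
    qed
    moreover have "\<forall>U\<in>(`) f ` \<F>. openin Y U \<and> U \<noteq> {}"
      using F op unfolding open_map_def by blast
    ultimately show ?thesis
      using assms(2) unfolding cellular_bound_def by blast
  qed
  finally show "|\<F>| \<le>o \<kappa>" .
qed

theorem theorem10:
  fixes \<kappa> :: "'k rel" and X :: "'y topology"
  assumes "Cinfinite \<kappa>"
    and "skeletal_class TYPE('i) TYPE('x) \<kappa> X"
  shows "cellularity X \<le>o \<kappa>"
proof -
  obtain S :: "'i set" and r and Xs :: "'i \<Rightarrow> 'x topology" and p
    where "complete_inverse_system \<kappa> S r Xs p" "limit_projections_onto S r Xs p"
      "\<forall>a\<in>S. weight (Xs a) \<le>o \<kappa>"
      "\<forall>a\<in>S. \<forall>b\<in>S. (a, b) \<in> r \<longrightarrow> skeletal_map (Xs b) (Xs a) (p b a)"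
      and X: "X homeomorphic_space inverse_limit S r Xs p"
    using assms(2) unfolding skeletal_class_def by blast
  then have "cellular_bound (inverse_limit S r Xs p) \<kappa>"
    using cellular_bound_inverse_limit[OF assms(1)] by blast
  \<comment> \<open>\<open>cellularity\<close> minimizes over cardinals on one fixed type, while
    \<kappa> lives on \<open>'k\<close>; \<open>cellularity_least\<close> compares across the
    types.\<close>
  then show ?thesis
    using cellularity_least[OF assms(1)] cellular_bound_homeomorphic[OF X] by blast
qed

end
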